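(* Let $\mathbf{x}_t\in\mathcal{X}$, $\mathbf{z}_t\in E^*$ ($t\ge 0$) evolve according to $$\dot{\mathbf{x}}_t=\frac{\dot\alpha_t(\nabla\psi^*(\mathbf{z}_t)-\mathbf{x}_t)}{\alpha_t},\qquad \dot{\mathbf{z}}_t=-h(\alpha_t)\frac{\dot\alpha_t}{\alpha_t}\nabla f(\mathbf{x}_t),$$ for an arbitrary initial point $\mathbf{x}_0=\nabla\psi^*(\mathbf{z}_0)\in\mathcal{X}$ and some differentiable $\psi^*(\cdot)$. Denote $\beta_t=h(\alpha_t)\alpha_t$. Then for all $t\ge 0$, $\frac{\mathrm{d}}{\mathrm{d}t}\mathcal{C}^f_t=0$ and $\frac{\mathrm{d}}{\mathrm{d}t}\mathcal{C}_t=0$, where $$\mathcal{C}^f_t=h(\alpha_t)f(\mathbf{x}_t)-\int_0^t f(\mathbf{x}_\tau)\frac{\mathrm{d}(h(\alpha_\tau))}{\mathrm{d}\tau}\,\mathrm{d}\tau+\int_0^t h(\alpha_\tau)\frac{\dot\alpha_\tau}{\alpha_\tau}\langle\nabla f(\mathbf{x}_\tau),\mathbf{x}_\tau\rangle\,\mathrm{d}\tau+\psi^*(\mathbf{z}_t),$$ $$\mathcal{C}_t=\beta_t f(\mathbf{x}_t)-\beta_0 f(\mathbf{x}_0)-\int_0^t\dot\beta_\tau f(\mathbf{x}_\tau)\,\mathrm{d}\tau+\alpha_0 D_{\psi^*}(\mathbf{z}_t,\mathbf{z}_0)+\int_0^t D_{\psi^*}(\mathbf{z}_t,\mathbf{z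}_\sigma)\dot\alpha_\sigma\,\mathrm{d}\sigma.$$
   Context: $E$ is a finite-dimensional real normed vector space with norm $\|\cdot\|$ and dual space $E^*$; $\langle\mathbf{z},\mathbf{x}\rangle$ is the value of $\mathbf{z}\in E^*$ at $\mathbf{x}\in E$. $\mathcal{X}\subseteq E$ is closed and convex, and $f:\mathcal{X}\to\mathbb{R}$ is continuously differentiable (possibly nonconvex), with Lipschitz gradient. $\psi:\mathcal{X}\to\mathbb{R}$ is a strongly convex function and $\psi^*(\mathbf{z})=\sup_{\mathbf{x}\in\mathcal{X}}\{\langle\mathbf{z},\mathbf{x}\rangle-\psi(\mathbf{x})\}$ is its convex conjugate on $E^*$; $\psi^*$ is continuously differentiable with $\nabla\psi^*(\mathbf{z})=\mathrm{argmax}_{\mathbf{x}\in\mathcal{X}}\{\langle\mathbf{z},\mathbf{x}\rangle-\psi(\mathbf{x})\}\in\mathcal{X}$. The Bregman divergence is $D_{\psi^*}(\mathbf{z},\mathbf{w})=\psi^*(\mathbf{z})-\psi^*(\mathbf{w})-\langle\mathbf{z}-\mathbf{w},\nabla\psi^*(\mathbf{w})\rangle$. $\alpha_t$ is a strictly increasing, continuously differentiable function of $t\geq 0$ with $\alpha_0>0$, and $h$ is a positive continuously differentiable function. *)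

theory Defs
  imports "HOL-Analysis.Analysis"
begin

text \<open>The dual of \<open>'a\<close> is the space \<open>'a \<Rightarrow>\<^sub>L real\<close> of bounded linear functionals with the operator
  (dual) norm, and \<open>blinfun_apply z u\<close> is the pairing of \<open>z\<close> with \<open>u\<close>.\<close>

text \<open>Time runs over \<open>{0..}\<close>, so derivatives in time are one-sided at \<open>0\<close>.\<close>

abbreviation time_deriv :: "(real \<Rightarrow> real) \<Rightarrow> real \<Rightarrow> real" where
  "time_deriv y t \<equiv> vector_derivative y (at t within {0..})"

definition strongly_convex_on :: "real \<Rightarrow> 'a::real_normed_vector set \<Rightarrow> ('a \<Rightarrow> real) \<Rightarrow> bool" where
  "strongly_convex_on m X \<psi> \<longleftrightarrow> m > 0 \<and> convex X \<and>
     (\<forall>u\<in>X. \<forall>v\<in>X. \<forall>s\<in>{0..1}.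
        \<psi> ((1 - s) *\<^sub>R u + s *\<^sub>R v)
          \<le> (1 - s) * \<psi> u + s * \<psi> v - m / 2 * s * (1 - s) * (norm (u - v))\<^sup>2)"

text \<open>The supremum is taken in the reals, so it is meaningful only when the set of values is
  nonempty and bounded above (e.g. when the supremum is attained).\<close>

definition convex_conj ::
  "'a::real_normed_vector set \<Rightarrow> ('a \<Rightarrow> real) \<Rightarrow> ('a \<Rightarrow>\<^sub>L real) \<Rightarrow> real" where
  "convex_conj X \<psi> z = (SUP u\<in>X. blinfun_apply z u - \<psi> u)"

text \<open>Gradient of a function on the dual space, as an element of the space itself: the derivative
  at \<open>w\<close> is evaluation at \<open>g w\<close>. Such a \<open>g\<close> is unique, since functionals separate points.\<close>

definition is_dual_gradient ::
  "(('a::real_normed_vector \<Rightarrow>\<^sub>L real) \<Rightarrow> real) \<Rightarrow> (('a \<Rightarrow>\<^sub>L real) \<Rightarrow> 'a) \<Rightarrow> bool" where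
  "is_dual_gradient \<phi> g \<longleftrightarrow> (\<forall>w. (\<phi> has_derivative (\<lambda>v. blinfun_apply v (g w))) (at w))"

text \<open>Bregman divergence of \<open>\<phi>\<close>, where \<open>g\<close> is the gradient of \<open>\<phi>\<close>.\<close>

definition bregman ::
  "(('a::real_normed_vector \<Rightarrow>\<^sub>L real) \<Rightarrow> real) \<Rightarrow> (('a \<Rightarrow>\<^sub>L real) \<Rightarrow> 'a)
    \<Rightarrow> ('a \<Rightarrow>\<^sub>L real) \<Rightarrow> ('a \<Rightarrow>\<^sub>L real) \<Rightarrow> real" where
  "bregman \<phi> g z w = \<phi> z - \<phi> w - blinfun_apply (z - w) (g w)"

end

theory Submission
  imports Defs
begin

text \<open>
  Both quantities are conserved because differentiating them produces only terms that the two
  differential equations make cancel.  Write \<open>g = \<nabla>\<psi>\<^sup>*\<close>; the chain rule along the trajectory gives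
  \<open>(f \<circ> x)' = (\<alpha>'/\<alpha>) \<langle>\<nabla>f x, g z - x\<rangle>\<close> and
  \<open>(\<psi>\<^sup>* \<circ> z)' = \<langle>z', g z\<rangle> = - h (\<alpha>'/\<alpha>) \<langle>\<nabla>f x, g z\<rangle>\<close>.

  For \<open>C\<^sup>f\<close> the first integral removes the part of \<open>(h f)'\<close> in which \<open>h\<close> is differentiated, and what
  is left is \<open>h (\<alpha>'/\<alpha>)\<close> times \<open>\<langle>\<nabla>f x, g z - x\<rangle> + \<langle>\<nabla>f x, x\<rangle> - \<langle>\<nabla>f x, g z\<rangle> = 0\<close>.

  For \<open>C\<close> the difficulty is that \<open>t\<close> occurs in the last integral both as a limit and in the
  integrand.  The equation for \<open>x\<close> says exactly that \<open>(\<alpha> x)' = \<alpha>' g z\<close>, so, given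
  \<open>x 0 = g (z 0)\<close>, the point \<open>x t\<close> is a weighted average of the gradients \<open>g (z \<sigma>)\<close>, \<open>\<sigma> \<le> t\<close>.
  Hence \<open>\<langle>z t, g (z \<sigma>)\<rangle>\<close>, the mixed term of the Bregman divergence, integrates against \<open>\<alpha>'\<close> to
  \<open>\<langle>z t, \<alpha> t x t - \<alpha> 0 x 0\<rangle>\<close>; in the other terms \<open>t\<close> enters only through the factor \<open>\<psi>\<^sup>* (z t)\<close>
  (\<open>integral_bregman_averaged\<close>).  Since \<open>x 0 = g (z 0)\<close>, the boundary terms of this expression
  combine with \<open>\<alpha> 0 D(z t, z 0)\<close>, and the derivative of the Bregman part of \<open>C\<close> is
  \<open>\<alpha> \<langle>z', g z - x\<rangle>\<close> (\<open>weighted_bregman_has_derivative\<close>): the envelope effect, in which the mean of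
  the gradients of \<open>D(\<cdot>, z \<sigma>)\<close> at \<open>z t\<close> is \<open>g (z t)\<close> minus the mean of the \<open>g (z \<sigma>)\<close>.
  By the equation for \<open>z\<close> this is \<open>- h \<alpha>' \<langle>\<nabla>f x, g z - x\<rangle> = - \<beta> (f \<circ> x)'\<close>, which cancels the other
  contribution to \<open>C'\<close>.
\<close>

section \<open>Calculus on the half-line\<close>

lemma time_deriv_eq:
  assumes "(y has_vector_derivative d) (at t within {0..})" "t \<ge> 0"
  shows "time_deriv y t = d"
proof (rule vector_derivative_within)
  show "at t within {0..} \<noteq> bot"
    using islimpt_subset[OF islimpt_greaterThanLessThan1[of t "t + 1"], of "{0..}"] assms(2)
    by (force simp: trivial_limit_within)
qed (fact assms(1))

text \<open>This is the fundamental theorem on \<open>{0..t + 1}\<close>, because \<open>t\<close> has the same small neighbourhoods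
  in that interval as in the half-line.\<close>

lemma integral_has_real_derivative_halfline:
  fixes k :: "real \<Rightarrow> real"
  assumes "continuous_on {0..} k" "t \<ge> 0"
  shows "((\<lambda>t. integral {0..t} k) has_real_derivative k t) (at t within {0..})"
proof -
  have "((\<lambda>t. integral {0..t} k) has_real_derivative k t) (at t within {0..t+1})"
    using assms by (intro integral_has_real_derivative continuous_on_subset[OF assms(1)]) auto
  moreover have "at t within {0..t+1} = at t within {0..}"
    using assms by (intro at_within_nhd[where S="{..<t+1}"]) auto
  ultimately show ?thesis by simp
qed

text \<open>The gradient of \<open>f\<close> is known only relative to \<open>X\<close>, which suffices for a curve that stays
  in \<open>X\<close>.\<close>

lemma has_real_derivative_along_curve:
  fixes f :: "'a::real_normed_vector \<Rightarrow> real"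
  assumes f: "(f has_derivative blinfun_apply G) (at (x t) within X)"
    and x: "(x has_vector_derivative v) (at t within T)"
    and "x ` T \<subseteq> X"
  shows "((\<lambda>t. f (x t)) has_real_derivative blinfun_apply G v) (at t within T)"
proof -
  have "((\<lambda>t. f (x t)) has_derivative (\<lambda>s. blinfun_apply G (s *\<^sub>R v))) (at t within T)"
    using has_derivative_in_compose[OF x[unfolded has_vector_derivative_def]
        has_derivative_subset[OF f assms(3)]] .
  then show ?thesis
    by (rule has_derivative_imp_has_field_derivative) (simp add: blinfun.scaleR_right)
qed

lemma dual_gradient_along_curve:
  assumes "is_dual_gradient \<phi> g"
    and z: "(z has_vector_derivative w) (at t within T)"
  shows "((\<lambda>t. \<phi> (z t)) has_real_derivative blinfun_apply w (g (z t))) (at t within T)"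
proof -
  have "(\<phi> has_derivative (\<lambda>v. blinfun_apply v (g (z t)))) (at (z t) within z ` T)"
    using assms(1) by (auto simp: is_dual_gradient_def intro: has_derivative_at_withinI)
  from has_derivative_in_compose[OF z[unfolded has_vector_derivative_def] this]
  have "((\<lambda>t. \<phi> (z t)) has_derivative (\<lambda>s. blinfun_apply (s *\<^sub>R w) (g (z t)))) (at t within T)" .
  then show ?thesis
    by (rule has_derivative_imp_has_field_derivative) (simp add: blinfun.scaleR_left)
qed

lemma pairing_has_real_derivative:
  assumes "(z has_vector_derivative w) (at t within T)"
    and "(x has_vector_derivative v) (at t within T)"
  shows "((\<lambda>t. blinfun_apply (z t) (x t)) has_real_derivative
      blinfun_apply (z t) v + blinfun_apply w (x t)) (at t within T)"
  using blinfun.has_vector_derivative[OF assms]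
  by (simp add: has_real_derivative_iff_has_vector_derivative)

lemma C1_compose_halfline:
  fixes h \<alpha> :: "real \<Rightarrow> real"
  assumes "h C1_differentiable_on {0<..}"
    and \<alpha>: "\<And>t. t \<ge> 0 \<Longrightarrow> (\<alpha> has_real_derivative \<alpha>' t) (at t within {0..})"
    and "continuous_on {0..} \<alpha>'"
    and pos: "\<And>t. t \<ge> 0 \<Longrightarrow> \<alpha> t > 0"
  obtains k where "\<And>t. t \<ge> 0 \<Longrightarrow> ((\<lambda>s. h (\<alpha> s)) has_real_derivative k t) (at t within {0..})"
    and "continuous_on {0..} k"
proof -
  obtain D where D: "\<And>s. s > 0 \<Longrightarrow> (h has_real_derivative D s) (at s)" "continuous_on {0<..} D"
    using assms(1)
    by (auto simp: C1_differentiable_on_def has_real_derivative_iff_has_vector_derivative)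
  show ?thesis
  proof
    show "((\<lambda>s. h (\<alpha> s)) has_real_derivative D (\<alpha> t) * \<alpha>' t) (at t within {0..})"
      if "t \<ge> 0" for t
      using DERIV_chain2[OF D(1)[OF pos[OF that]] \<alpha>[OF that]] .
    have "continuous_on {0..} \<alpha>"
      using \<alpha> by (intro DERIV_continuous_on) auto
    then show "continuous_on {0..} (\<lambda>t. D (\<alpha> t) * \<alpha>' t)"
      using assms(3) pos by (intro continuous_on_mult continuous_on_compose2[OF D(2)]) auto
  qed
qed

section \<open>Bregman divergences averaged along a curve\<close>

text \<open>The hypothesis on \<open>P\<close> turns the integrand that mixes the endpoint with \<open>\<sigma>\<close>, the one
  with \<open>\<langle>z b, g (z \<sigma>)\<rangle>\<close>, into an exact derivative in \<open>\<sigma>\<close>.  Pairing with the fixed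
  functional \<open>z b\<close> before integrating keeps all integrals real valued.\<close>

lemma integral_bregman_averaged:
  fixes z :: "real \<Rightarrow> ('a::real_normed_vector \<Rightarrow>\<^sub>L real)"
  assumes "a \<le> b"
    and \<phi>: "continuous_on {a..b} (\<lambda>\<sigma>. \<phi> (z \<sigma>))"
    and z: "continuous_on {a..b} z"
    and g: "continuous_on {a..b} (\<lambda>\<sigma>. g (z \<sigma>))"
    and \<alpha>': "continuous_on {a..b} \<alpha>'"
    and \<alpha>: "\<And>\<sigma>. \<sigma> \<in> {a..b} \<Longrightarrow> (\<alpha> has_real_derivative \<alpha>' \<sigma>) (at \<sigma> within {a..b})"
    and P: "\<And>\<sigma>. \<sigma> \<in> {a..b} \<Longrightarrow> (P has_vector_derivative \<alpha>' \<sigma> *\<^sub>R g (z \<sigma>)) (at \<sigma> within {a..b})"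
  shows "integral {a..b} (\<lambda>\<sigma>. bregman \<phi> g (z b) (z \<sigma>) * \<alpha>' \<sigma>) =
      \<phi> (z b) * (\<alpha> b - \<alpha> a) - blinfun_apply (z b) (P b - P a)
      + integral {a..b} (\<lambda>\<sigma>. (blinfun_apply (z \<sigma>) (g (z \<sigma>)) - \<phi> (z \<sigma>)) * \<alpha>' \<sigma>)"
proof -
  have "(\<alpha>' has_integral (\<alpha> b - \<alpha> a)) {a..b}"
    using \<alpha> by (intro fundamental_theorem_of_calculus assms(1))
      (auto simp: has_real_derivative_iff_has_vector_derivative)
  then have 1: "((\<lambda>\<sigma>. \<phi> (z b) * \<alpha>' \<sigma>) has_integral \<phi> (z b) * (\<alpha> b - \<alpha> a)) {a..b}"
    by (rule has_integral_mult_right)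
  have 2: "((\<lambda>\<sigma>. blinfun_apply (z b) (\<alpha>' \<sigma> *\<^sub>R g (z \<sigma>))) has_integral
      (blinfun_apply (z b) (P b) - blinfun_apply (z b) (P a))) {a..b}"
    using P by (intro fundamental_theorem_of_calculus assms(1)
        bounded_linear.has_vector_derivative[OF blinfun.bounded_linear_right])
  have "continuous_on {a..b} (\<lambda>\<sigma>. (blinfun_apply (z \<sigma>) (g (z \<sigma>)) - \<phi> (z \<sigma>)) * \<alpha>' \<sigma>)"
    by (intro continuous_intros blinfun.continuous_on z g \<phi> \<alpha>')
  from has_integral_add[OF has_integral_diff[OF 1 2]
      integrable_integral[OF integrable_continuous_real[OF this]]]
  show ?thesis
    by (intro integral_unique) (simp add: bregman_def blinfun.diff_left blinfun.diff_right
        blinfun.scaleR_right algebra_simps)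
qed

text \<open>The envelope effect: once the average of the divergences is written in closed form, its
  terms containing \<open>\<alpha>'\<close> cancel on differentiation, and only the motion of \<open>z t\<close> as first argument
  contributes.  The condition \<open>x 0 = g (z 0)\<close> makes the atom of weight \<open>\<alpha> 0\<close> at time \<open>0\<close>
  belong to the same average as the density \<open>\<alpha>'\<close>.\<close>

lemma weighted_bregman_has_derivative:
  fixes z :: "real \<Rightarrow> ('a::real_normed_vector \<Rightarrow>\<^sub>L real)" and x :: "real \<Rightarrow> 'a"
  assumes grad: "is_dual_gradient \<phi> g"
    and g: "continuous_on UNIV g"
    and \<alpha>': "continuous_on {0..} \<alpha>'"
    and \<alpha>: "\<And>t. t \<ge> 0 \<Longrightarrow> (\<alpha> has_real_derivative \<alpha>' t) (at t within {0..})"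
    and z: "\<And>t. t \<ge> 0 \<Longrightarrow> (z has_vector_derivative z' t) (at t within {0..})"
    and \<alpha>x: "\<And>t. t \<ge> 0 \<Longrightarrow>
      ((\<lambda>s. \<alpha> s *\<^sub>R x s) has_vector_derivative \<alpha>' t *\<^sub>R g (z t)) (at t within {0..})"
    and x0: "x 0 = g (z 0)"
    and t: "t \<ge> 0"
  shows "((\<lambda>t. \<alpha> 0 * bregman \<phi> g (z t) (z 0)
        + integral {0..t} (\<lambda>\<sigma>. bregman \<phi> g (z t) (z \<sigma>) * \<alpha>' \<sigma>))
      has_real_derivative \<alpha> t * blinfun_apply (z' t) (g (z t) - x t)) (at t within {0..})"
proof -
  have cz: "continuous_on {0..} z"
    using z by (intro continuous_on_vector_derivative) auto
  have cg: "continuous_on {0..} (\<lambda>s. g (z s))"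
    by (intro continuous_on_compose2[OF g cz]) auto
  have \<phi>z: "((\<lambda>s. \<phi> (z s)) has_real_derivative blinfun_apply (z' t) (g (z t))) (at t within {0..})"
    if "t \<ge> 0" for t
    using dual_gradient_along_curve[OF grad z[OF that]] .
  have c\<phi>: "continuous_on {0..} (\<lambda>s. \<phi> (z s))"
    using \<phi>z by (intro DERIV_continuous_on) auto
  define k where "k \<sigma> = (blinfun_apply (z \<sigma>) (g (z \<sigma>)) - \<phi> (z \<sigma>)) * \<alpha>' \<sigma>" for \<sigma>
  have ck: "continuous_on {0..} k"
    unfolding k_def by (intro continuous_intros blinfun.continuous_on cz cg c\<phi> \<alpha>')
  have closed_form: "\<alpha> 0 * bregman \<phi> g (z s) (z 0)
        + integral {0..s} (\<lambda>\<sigma>. bregman \<phi> g (z s) (z \<sigma>) * \<alpha>' \<sigma>) =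
      \<alpha> s * \<phi> (z s) - blinfun_apply (z s) (\<alpha> s *\<^sub>R x s) + integral {0..s} k
      + \<alpha> 0 * (blinfun_apply (z 0) (x 0) - \<phi> (z 0))" if "s \<ge> 0" for s
  proof -
    have sub: "{0..s} \<subseteq> {0..}" by auto
    have "integral {0..s} (\<lambda>\<sigma>. bregman \<phi> g (z s) (z \<sigma>) * \<alpha>' \<sigma>) =
      \<phi> (z s) * (\<alpha> s - \<alpha> 0) - blinfun_apply (z s) (\<alpha> s *\<^sub>R x s - \<alpha> 0 *\<^sub>R x 0) + integral {0..s} k"
      unfolding k_def
      using that \<alpha> \<alpha>x
      by (intro integral_bregman_averaged continuous_on_subset[OF c\<phi> sub]
          continuous_on_subset[OF cz sub] continuous_on_subset[OF cg sub]
          continuous_on_subset[OF \<alpha>' sub])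
        (auto intro: DERIV_subset[OF _ sub] has_vector_derivative_within_subset[OF _ sub])
    then show ?thesis
      by (simp add: bregman_def x0 blinfun.diff_left blinfun.diff_right blinfun.scaleR_right
          algebra_simps)
  qed
  have "((\<lambda>s. \<alpha> s * \<phi> (z s) - blinfun_apply (z s) (\<alpha> s *\<^sub>R x s) + integral {0..s} k
        + \<alpha> 0 * (blinfun_apply (z 0) (x 0) - \<phi> (z 0)))
      has_real_derivative \<alpha> t * blinfun_apply (z' t) (g (z t) - x t)) (at t within {0..})"
    by (rule derivative_eq_intros \<alpha> \<phi>z pairing_has_real_derivative[OF z \<alpha>x]
        integral_has_real_derivative_halfline[OF ck] t refl)+
      (simp add: k_def blinfun.diff_right blinfun.scaleR_right algebra_simps)
  then show ?thesis
    by (rule has_field_derivative_transform_within[where d=1]) (use t closed_form in auto)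
qed

section \<open>The conserved quantities\<close>

theorem lemma2p3:
  fixes X :: "'a::real_normed_vector set"
    and f \<psi> :: "'a \<Rightarrow> real"
    and grad_f :: "'a \<Rightarrow> ('a \<Rightarrow>\<^sub>L real)"
    and \<psi>s :: "('a \<Rightarrow>\<^sub>L real) \<Rightarrow> real"
    and grad_\<psi>s :: "('a \<Rightarrow>\<^sub>L real) \<Rightarrow> 'a"
    and \<alpha> h \<beta> :: "real \<Rightarrow> real"
    and x :: "real \<Rightarrow> 'a"
    and z :: "real \<Rightarrow> ('a \<Rightarrow>\<^sub>L real)"
    and Cf C :: "real \<Rightarrow> real"
  assumes fin_dim: "\<exists>B::'a set. finite B \<and> span B = UNIV"
    and X: "closed X" "convex X"
    and f_deriv: "\<And>u. u \<in> X \<Longrightarrow> (f has_derivative blinfun_apply (grad_f u)) (at u within X)"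
    and grad_f_cont: "continuous_on X grad_f"
    and grad_f_lipschitz: "\<exists>L. L-lipschitz_on X grad_f"
    and \<psi>_strongly_convex: "\<exists>m. strongly_convex_on m X \<psi>"
    and \<psi>s_def: "\<psi>s = convex_conj X \<psi>"
    and \<psi>s_grad: "is_dual_gradient \<psi>s grad_\<psi>s"
    and grad_\<psi>s_cont: "continuous_on UNIV grad_\<psi>s"
    and grad_\<psi>s_argmax:
      "\<And>w. is_arg_max (\<lambda>u. blinfun_apply w u - \<psi> u) (\<lambda>u. u \<in> X) (grad_\<psi>s w)"
    and \<alpha>_mono: "strict_mono_on {0..} \<alpha>"
    and \<alpha>_diff: "\<And>t. t \<ge> 0 \<Longrightarrow> \<alpha> differentiable (at t within {0..})"
    and \<alpha>_C1: "continuous_on {0..} (time_deriv \<alpha>)"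
    and \<alpha>_0: "\<alpha> 0 > 0"
    and h_pos: "\<And>s. s > 0 \<Longrightarrow> h s > 0"
    and h_C1: "h C1_differentiable_on {0<..}"
    and x_in_X: "\<And>t. t \<ge> 0 \<Longrightarrow> x t \<in> X"
    and x_ode: "\<And>t. t \<ge> 0 \<Longrightarrow>
      (x has_vector_derivative (time_deriv \<alpha> t / \<alpha> t) *\<^sub>R (grad_\<psi>s (z t) - x t))
        (at t within {0..})"
    and z_ode: "\<And>t. t \<ge> 0 \<Longrightarrow>
      (z has_vector_derivative - ((h (\<alpha> t) * (time_deriv \<alpha> t / \<alpha> t)) *\<^sub>R grad_f (x t)))
        (at t within {0..})"
    and x_0: "x 0 = grad_\<psi>s (z 0)"
    and \<beta>_def: "\<beta> = (\<lambda>t. h (\<alpha> t) * \<alpha> t)"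
    and Cf_def: "Cf = (\<lambda>t.
      h (\<alpha> t) * f (x t)
      - integral {0..t} (\<lambda>\<tau>. f (x \<tau>) * time_deriv (\<lambda>s. h (\<alpha> s)) \<tau>)
      + integral {0..t}
          (\<lambda>\<tau>. h (\<alpha> \<tau>) * (time_deriv \<alpha> \<tau> / \<alpha> \<tau>) * blinfun_apply (grad_f (x \<tau>)) (x \<tau>))
      + \<psi>s (z t))"
    and C_def: "C = (\<lambda>t.
      \<beta> t * f (x t) - \<beta> 0 * f (x 0)
      - integral {0..t} (\<lambda>\<tau>. time_deriv \<beta> \<tau> * f (x \<tau>))
      + \<alpha> 0 * bregman \<psi>s grad_\<psi>s (z t) (z 0)
      + integral {0..t} (\<lambda>\<sigma>. bregman \<psi>s grad_\<psi>s (z t) (z \<sigma>) * time_deriv \<alpha> \<sigma>))"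
  shows "\<forall>t\<ge>0. (Cf has_real_derivative 0) (at t within {0..})
              \<and> (C has_real_derivative 0) (at t within {0..})"
proof (intro allI impI)
  let ?a = "time_deriv \<alpha>"
  let ?q = "\<lambda>t. ?a t / \<alpha> t"
  fix t :: real
  assume t: "t \<ge> 0"
  have pos: "\<alpha> s > 0" if "s \<ge> 0" for s
    using strict_mono_on_leD[OF \<alpha>_mono, of 0 s] that \<alpha>_0 by auto
  have \<alpha>: "(\<alpha> has_real_derivative ?a s) (at s within {0..})" if "s \<ge> 0" for s
    using \<alpha>_diff[OF that]
    by (simp add: vector_derivative_works has_real_derivative_iff_has_vector_derivative)
  obtain k where k: "\<And>s. s \<ge> 0 \<Longrightarrow>
      ((\<lambda>s. h (\<alpha> s)) has_real_derivative k s) (at s within {0..})"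
    and ck: "continuous_on {0..} k"
    using C1_compose_halfline[OF h_C1 \<alpha> \<alpha>_C1 pos] by blast
  have k_eq: "time_deriv (\<lambda>s. h (\<alpha> s)) s = k s" if "s \<ge> 0" for s
    using k[OF that] that
    by (intro time_deriv_eq) (auto simp: has_real_derivative_iff_has_vector_derivative)
  have \<beta>: "(\<beta> has_real_derivative k s * \<alpha> s + h (\<alpha> s) * ?a s) (at s within {0..})"
    if "s \<ge> 0" for s
    unfolding \<beta>_def by (rule derivative_eq_intros k \<alpha> that refl)+ simp
  have \<beta>_eq: "time_deriv \<beta> s = k s * \<alpha> s + h (\<alpha> s) * ?a s" if "s \<ge> 0" for s
    using \<beta>[OF that] that
    by (intro time_deriv_eq) (auto simp: has_real_derivative_iff_has_vector_derivative)
  have fx: "((\<lambda>s. f (x s)) has_real_derivative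
      ?q s * blinfun_apply (grad_f (x s)) (grad_\<psi>s (z s) - x s)) (at s within {0..})"
    if "s \<ge> 0" for s
    using has_real_derivative_along_curve[OF f_deriv[OF x_in_X[OF that]] x_ode[OF that]] x_in_X
    by (auto simp: blinfun.scaleR_right)
  have c\<alpha>: "continuous_on {0..} \<alpha>" and ch: "continuous_on {0..} (\<lambda>s. h (\<alpha> s))"
    and cf: "continuous_on {0..} (\<lambda>s. f (x s))"
    using \<alpha> k fx by (auto intro!: DERIV_continuous_on)
  have cx: "continuous_on {0..} x"
    using x_ode by (intro continuous_on_vector_derivative) auto
  have cgrad: "continuous_on {0..} (\<lambda>s. grad_f (x s))"
    using x_in_X by (intro continuous_on_compose2[OF grad_f_cont cx]) auto

  have "continuous_on {0..} (\<lambda>\<tau>. f (x \<tau>) * time_deriv (\<lambda>s. h (\<alpha> s)) \<tau>)"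
    using continuous_on_mult[OF cf ck] by (rule continuous_on_eq) (simp add: k_eq)
  note I1 = integral_has_real_derivative_halfline[OF this t]
  have "continuous_on {0..} (\<lambda>\<tau>. h (\<alpha> \<tau>) * ?q \<tau> * blinfun_apply (grad_f (x \<tau>)) (x \<tau>))"
    using pos by (intro continuous_intros blinfun.continuous_on ch \<alpha>_C1 c\<alpha> cgrad cx)
      (auto simp: less_imp_neq[symmetric])
  note I2 = integral_has_real_derivative_halfline[OF this t]
  have "continuous_on {0..} (\<lambda>s. (k s * \<alpha> s + h (\<alpha> s) * ?a s) * f (x s))"
    by (intro continuous_intros ck c\<alpha> ch \<alpha>_C1 cf)
  then have "continuous_on {0..} (\<lambda>\<tau>. time_deriv \<beta> \<tau> * f (x \<tau>))"
    by (rule continuous_on_eq) (simp add: \<beta>_eq)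
  note I3 = integral_has_real_derivative_halfline[OF this t]

  have "(Cf has_real_derivative 0) (at t within {0..})"
    unfolding Cf_def
    by (rule derivative_eq_intros k[OF t] fx[OF t] I1 I2
        dual_gradient_along_curve[OF \<psi>s_grad z_ode[OF t]] refl)+
      (simp add: k_eq t blinfun.diff_right blinfun.scaleR_left blinfun.minus_left algebra_simps)

  moreover have "(C has_real_derivative 0) (at t within {0..})"
  proof -
    \<comment> \<open>The equation for \<open>x\<close> as a statement about averages: the terms in \<open>\<alpha>' x\<close> cancel.\<close>
    have \<alpha>x: "((\<lambda>s. \<alpha> s *\<^sub>R x s) has_vector_derivative ?a s *\<^sub>R grad_\<psi>s (z s)) (at s within {0..})"
      if "s \<ge> 0" for s
      using has_vector_derivative_scaleR[OF \<alpha>[OF that] x_ode[OF that]] pos[OF that]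
      by (simp add: scaleR_diff_right)
    note B = weighted_bregman_has_derivative[OF \<psi>s_grad grad_\<psi>s_cont \<alpha>_C1 \<alpha> z_ode \<alpha>x x_0 t]
    have "((\<lambda>t. \<beta> t * f (x t) - \<beta> 0 * f (x 0)
        - integral {0..t} (\<lambda>\<tau>. time_deriv \<beta> \<tau> * f (x \<tau>)))
      has_real_derivative
        h (\<alpha> t) * ?a t * blinfun_apply (grad_f (x t)) (grad_\<psi>s (z t) - x t))
      (at t within {0..})"
      by (rule derivative_eq_intros \<beta>[OF t] fx[OF t] I3 refl)+
        (use pos[OF t] in \<open>simp add: \<beta>_eq[OF t], simp add: \<beta>_def\<close>)
    from DERIV_add[OF this B] show ?thesis
      using pos[OF t]
      by (simp add: C_def add.assoc blinfun.scaleR_left blinfun.minus_left)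
  qed
  ultimately show "(Cf has_real_derivative 0) (at t within {0..})
      \<and> (C has_real_derivative 0) (at t within {0..})" ..
qed

end
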